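(* Let $k\ge 3$ and $n\ge k$, and let $S^{(k)}(n)$ be the number of straddling palindromes of $W^{(k)}_n$. Then $S^{(k)}(n)=2^{n-2k+2}-1$ if $2k-1\le n<3k-2$; $S^{(k)}(n)=2^k-2$ if $n=3k-2$; and $S^{(k)}(n)=0$ otherwise.
   Context: The alphabet is $\mathbb{N}=\{0,1,2,\dots\}$. For an integer $k\ge 3$, $\varphi_k$ is the morphism of $\mathbb{N}^*$ defined on letters, for $i\ge 0$ and $0\le j\le k-1$, by $\varphi_k(ki+j)=(ki)(ki+j+1)$ (two letters) if $0\le j\le k-2$, and $\varphi_k(ki+k-1)=(ki+k)$ (one letter). For $n\ge 0$, $W^{(k)}_n=\varphi_k^n(0)$. For a finite word $W=w_1\cdots w_m$, $W[s,t]=w_s\cdots w_t$. For $n\ge k$ let $e=\sum_{i=n-k+1}^{n-1}|W^{(k)}_i|$ (so that $W^{(k)}_n[1,e]$ is the part $W^{(k)}_{n-1}W^{(k)}_{n-2}\cdots W^{(k)}_{n-k+1}$ and $W^{(k)}_n[e+1,|W^{(k)}_n|]$ is the part $k\oplus W^{(k)}_{n-k}$, where $k\oplus W$ adds $k$ to every letter of $W$). A straddling palindrome of $W^{(k)}_n$ is a pair $(s,t)$ with $1\le s\le e<t\le |W^{(k)}_n|$ such that $W^{(k)}_n[s,t]$ is a palindrome; they are counted by position. *)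

theory Defs
  imports Main
begin

text \<open>
  Finite words over the alphabet of natural numbers are lists. A letter \<open>a\<close> is written
  \<open>a = k * i + j\<close> with \<open>i = a div k\<close> and \<open>j = a mod k\<close>. The definitions are intended
  for \<open>k \<ge> 3\<close>.
\<close>

definition phi_letter :: "nat \<Rightarrow> nat \<Rightarrow> nat list" where
  "phi_letter k a =
     (let i = a div k; j = a mod k
      in if j \<le> k - 2 then [k * i, k * i + j + 1] else [k * i + k])"

definition phi :: "nat \<Rightarrow> nat list \<Rightarrow> nat list" where
  "phi k w = concat (map (phi_letter k) w)"

definition W :: "nat \<Rightarrow> nat \<Rightarrow> nat list" where
  "W k n = (phi k ^^ n) [0]"

text \<open>The factor \<open>w\<^sub>s \<cdots> w\<^sub>t\<close>, with positions counted from 1 and \<open>1 \<le> s \<le> t \<le> length w\<close>.\<close>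

definition subword :: "'a list \<Rightarrow> nat \<Rightarrow> nat \<Rightarrow> 'a list" where
  "subword w s t = take (t + 1 - s) (drop (s - 1) w)"

definition palindrome :: "'a list \<Rightarrow> bool" where
  "palindrome w \<longleftrightarrow> rev w = w"

definition cut :: "nat \<Rightarrow> nat \<Rightarrow> nat" where
  "cut k n = (\<Sum>i = n - k + 1..n - 1. length (W k i))"

definition straddling_palindromes :: "nat \<Rightarrow> nat \<Rightarrow> (nat \<times> nat) set" where
  "straddling_palindromes k n =
     {(s, t). 1 \<le> s \<and> s \<le> cut k n \<and> cut k n < t \<and> t \<le> length (W k n)
        \<and> palindrome (subword (W k n) s t)}"

definition S :: "nat \<Rightarrow> nat \<Rightarrow> nat" where
  "S k n = card (straddling_palindromes k n)"

end

theory Submission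
  imports Defs "HOL-Library.Sublist"
begin

text \<open>
  The letters on the two sides of the cut are \<open>n - k + 1\<close> and \<open>k\<close>, so a straddling palindrome
  also contains \<open>k\<close> followed by \<open>n - k + 1\<close>. Only few pairs of letters are adjacent in
  \<open>W k n\<close>, and this already forces \<open>n = 2 * k - 1 + q\<close> with \<open>q < k\<close>. Then, writing \<open>V\<close> for
  the palindrome \<open>butlast (W k q)\<close> and shifting by \<open>k\<close>, the word around the cut is
  \<open>\<dots> (q + 1) [V q] | [V q] \<dots>\<close>, where only the bracketed parts are shifted. The letter \<open>q + 1\<close>
  on the left cannot be reached, again because of its neighbours. The mirror image of the
  \<open>q\<close> before the cut is this letter itself or the \<open>q\<close> in the right bracket, as otherwise the
  right part would contain \<open>q V q\<close>, which by desubstitution would produce the factor \<open>0 0\<close>.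
  This leaves two centres. The radius is limited by the letter \<open>q + 1\<close>, or, if \<open>q = k - 1\<close>,
  around the second centre by a letter \<open>2 * k\<close> which comes one position earlier.
\<close>

section \<open>Palindromic factors\<close>

lemma subword_decomp:
  assumes "1 \<le> s" "s \<le> t"
  shows "w = take (s - 1) w @ subword w s t @ drop t w"
proof -
  have "drop (t + 1 - s) (drop (s - 1) w) = drop t w"
    using assms by simp
  then show ?thesis
    unfolding subword_def by (metis append_take_drop_id)
qed

lemma sublist_subword:
  assumes "1 \<le> s" "s \<le> t"
  shows "sublist (subword w s t) w"
  using subword_decomp[OF assms] unfolding sublist_def by blast

lemma length_subword: "1 \<le> s \<Longrightarrow> s \<le> t \<Longrightarrow> t \<le> length w \<Longrightarrow> length (subword w s t) = t + 1 - s"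
  unfolding subword_def by simp

text \<open>Position \<open>i\<close>, counted from 1, is mirrored to \<open>s + t - i\<close>; the
  extra \<open>- 1\<close> on both sides passes to list indices, which start at 0.\<close>

lemma palindrome_subword_nth:
  assumes "palindrome (subword w s t)" "1 \<le> s" "t \<le> length w" "s \<le> i" "i \<le> t"
  shows "w ! (s + t - i - 1) = w ! (i - 1)"
proof -
  let ?p = "subword w s t"
  have len: "length ?p = t + 1 - s"
    using assms by (simp add: length_subword)
  have nth: "?p ! j = w ! (s - 1 + j)" if "j < t + 1 - s" for j
    using that assms unfolding subword_def by simp
  have "rev ?p ! (i - s) = ?p ! (t - i)"
    using assms len by (simp add: rev_nth)
  moreover have "rev ?p = ?p"
    using assms unfolding palindrome_def by simp
  moreover have "t - i < t + 1 - s" "i - s < t + 1 - s" using assms by auto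
  ultimately have "w ! (s - 1 + (t - i)) = w ! (s - 1 + (i - s))"
    using nth by metis
  moreover have "s - 1 + (t - i) = s + t - i - 1" "s - 1 + (i - s) = i - 1"
    using assms by auto
  ultimately show ?thesis by simp
qed

text \<open>Trimming equally many letters from both ends of a palindrome leaves a palindrome. The
  condition on \<open>s + t\<close> says that the factor has the same centre as \<open>p\<close>;
  the \<open>i\<close> of the proof counts the letters trimmed at each end.\<close>

lemma palindrome_centred:
  assumes "palindrome p" "length A < s" "s + t = 2 * length A + length p + 1" "s \<le> t"
  shows "palindrome (subword (A @ p @ B) s t)"
proof -
  define i where "i = s - 1 - length A"
  have st: "s = length A + i + 1" "t + i = length A + length p"
    using assms by (auto simp: i_def)
  have "2 * i < length p" using st assms by linarith
  have "subword (A @ p @ B) s t = take (length p - 2 * i) (drop i p)"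
  proof -
    have "t + 1 - s = length p - 2 * i" "i \<le> length p" using st assms by auto
    then show ?thesis using st \<open>2 * i < length p\<close> unfolding subword_def by simp
  qed
  moreover have "rev (take (length p - 2 * i) (drop i p)) = take (length p - 2 * i) (drop i p)"
  proof (rule nth_equalityI)
    fix j assume "j < length (rev (take (length p - 2 * i) (drop i p)))"
    then have j: "j < length p - 2 * i" by simp
    have "rev (take (length p - 2 * i) (drop i p)) ! j = p ! (length p - Suc (i + j))"
    proof -
      have "length p - 2 * i - Suc j + i = length p - Suc (i + j)" using j by auto
      then show ?thesis using j by (simp add: rev_nth add.commute)
    qed
    also have "\<dots> = rev p ! (i + j)" using j by (simp add: rev_nth)
    also have "\<dots> = p ! (i + j)" using assms unfolding palindrome_def by simp
    finally show "rev (take (length p - 2 * i) (drop i p)) ! j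
        = take (length p - 2 * i) (drop i p) ! j" using j by simp
  qed simp
  ultimately show ?thesis unfolding palindrome_def by simp
qed

text \<open>The bounds on \<open>s\<close> and \<open>t\<close> place \<open>u\<close> inside the
  palindrome, which equals its own reversal. The lemma turns an adjacency around the cut into a
  reversed one that may be impossible.\<close>

lemma sublist_rev_if_palindrome:
  assumes w: "w = A @ u @ B"
    and "palindrome (subword w s t)" "1 \<le> s" "s \<le> length A + 1" "u \<noteq> []"
    "length A + length u \<le> t"
  shows "sublist (rev u) w"
proof -
  let ?p = "subword w s t"
  have st: "s \<le> t" using assms by (cases u) auto
  have "drop (s - 1) w = drop (s - 1) A @ u @ B" using assms by simp
  then have "?p = drop (s - 1) A @ u @ take (t - length A - length u) B"
    using assms st unfolding subword_def by (auto simp: algebra_simps)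
  then have u: "sublist u ?p" unfolding sublist_def by blast
  have "rev ?p = ?p" using assms(2) unfolding palindrome_def .
  with u have "sublist (rev u) ?p" by (metis sublist_rev)
  then show ?thesis using sublist_subword[OF assms(3) st] sublist_order.order.trans by blast
qed

lemma straddling_palindrome_centre:
  fixes A V Z :: "'a list"
  defines "e \<equiv> length A + length V + 1"
  assumes w: "w = A @ V @ [c] @ V @ [c] @ Z" and V: "rev V = V" "c \<notin> set V"
    and pal: "palindrome (subword w s t)" "length A < s" "s \<le> e" "e < t" "t \<le> length w"
    and nofac: "\<not> sublist (c # V @ [c]) (V @ [c] @ Z)"
  shows "s + t = 2 * e \<or> s + t = 2 * e + length V + 1"
proof (rule ccontr)
  assume contra: "\<not> ?thesis"
  \<comment> \<open>The mirror image of position \<open>e\<close>.\<close>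
  define m where "m = s + t - e"
  have m: "s \<le> m" "m \<le> t" "m + e = s + t" using pal by (auto simp: m_def)
  have nth_V1: "w ! (length A + i) = V ! i" if "i < length V" for i
    using that by (simp add: w nth_append)
  have nth_c1: "w ! (e - 1) = c" by (simp add: w e_def nth_append)
  have nth_R: "w ! (e + i) = (V @ [c] @ Z) ! i" for i
    by (simp add: w e_def nth_append)
  have mirror: "w ! (s + t - i - 1) = w ! (i - 1)" if "s \<le> i" "i \<le> t" for i
    by (rule palindrome_subword_nth) (use pal that in auto)
  have wm: "w ! (m - 1) = c"
    using mirror[of e] pal nth_c1 by (simp add: m_def)
  consider "m < e" | "e < m" "m \<le> e + length V" | "e + length V + 1 < m"
    using contra m by linarith
  then show False
  proof cases
    case 1
    define i where "i = m - 1 - length A"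
    have "i < length V" "m - 1 = length A + i" using 1 m pal by (auto simp: i_def e_def)
    then have "c = V ! i" using wm nth_V1 by metis
    then show False using V \<open>i < length V\<close> by auto
  next
    case 2
    define i where "i = m - 1 - e"
    have i: "i < length V" "m - 1 = e + i" using 2 by (auto simp: i_def)
    then have "c = V ! i" using wm nth_R[of i] by (simp add: nth_append)
    then show False using V i by auto
  next
    case 3
    let ?d = "length V + 1" and ?R = "V @ [c] @ Z"
    \<comment> \<open>The offset in \<open>?R\<close> at which the mirror image of the block
      \<open>c # V @ [c]\<close> begins.\<close>
    define j where "j = m - ?d - 1 - e"
    have j: "m = e + j + ?d + 1" using 3 by (auto simp: j_def)
    have lenw: "length w = e + length ?R" by (simp add: w e_def)
    have len: "j + ?d < length ?R"
      using m pal lenw j by linarith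
    let ?f = "c # V @ [c]"
    have "take (?d + 1) (drop j ?R) = rev ?f"
    proof (rule nth_equalityI)
      show "length (take (?d + 1) (drop j ?R)) = length (rev ?f)" using len by simp
    next
      fix i assume "i < length (take (?d + 1) (drop j ?R))"
      then have i: "i \<le> ?d" by simp
      have "take (?d + 1) (drop j ?R) ! i = ?R ! (j + i)"
      proof -
        have "i < ?d + 1" "j \<le> length ?R" using i len by linarith+
        then show ?thesis by (metis nth_take nth_drop)
      qed
      also have "\<dots> = w ! (e + j + i)" using nth_R[of "j + i"] by (simp add: add.assoc)
      also have "\<dots> = w ! (e + ?d - i - 1)"
      proof -
        have "s + t - (e + j + i + 1) - 1 = e + ?d - i - 1" using m j by auto
        moreover have "s \<le> e + j + i + 1" "e + j + i + 1 \<le> t" using m j i pal by auto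
        ultimately show ?thesis using mirror[of "e + j + i + 1"] by simp
      qed
      also have "\<dots> = ?f ! (?d - i)"
      proof (cases "?d - i")
        case 0 then show ?thesis using i nth_c1 by simp
      next
        case (Suc l)
        then have "e + ?d - i - 1 = e + l" "l \<le> length V" by auto
        then show ?thesis using nth_R[of l] Suc by (simp add: nth_append)
      qed
      also have "\<dots> = rev ?f ! i"
      proof -
        have "length ?f - Suc i = ?d - i" by simp
        then show ?thesis using i by (metis rev_nth length_Cons length_append_singleton
              Suc_eq_plus1 less_Suc_eq_le)
      qed
      finally show "take (?d + 1) (drop j ?R) ! i = rev ?f ! i" .
    qed
    moreover have "rev ?f = ?f" using V by simp
    ultimately have "sublist ?f ?R"
      by (metis sublist_take sublist_drop sublist_order.order.trans)
    then show False using nofac by simp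
  qed
qed

section \<open>The words \<open>W k n\<close>\<close>

lemma phi_Nil [simp]: "phi k [] = []"
  and phi_Cons [simp]: "phi k (a # w) = phi_letter k a @ phi k w"
  and phi_append [simp]: "phi k (u @ v) = phi k u @ phi k v"
  by (simp_all add: phi_def)

lemma W_0 [simp]: "W k 0 = [0]"
  and W_Suc: "W k (Suc n) = phi k (W k n)"
  by (simp_all add: W_def)

text \<open>The adjacent pairs of letters, weakened just enough to be preserved by \<open>phi\<close>.\<close>

definition follows :: "nat \<Rightarrow> nat \<Rightarrow> nat \<Rightarrow> bool" where
  "follows k a b \<longleftrightarrow>
     (a = 0 \<longrightarrow> 0 < b \<and> b < k) \<and> (0 < a \<and> a < k \<longrightarrow> b = 0 \<or> b = k) \<and>
     (a = k \<longrightarrow> b = 0 \<or> k \<le> b \<and> b < 2 * k) \<and> (k < a \<longrightarrow> b = 0 \<or> k \<le> b)"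

context
  fixes k :: nat
  assumes k3: "k \<ge> 3"
begin

section \<open>Images of single letters, and first and last letters of the words\<close>

lemma phi_letter_cases:
  obtains (two) i j where "a = k * i + j" "j \<le> k - 2" "phi_letter k a = [k * i, a + 1]"
  | (one) i where "a = k * i + (k - 1)" "phi_letter k a = [a + 1]" "a + 1 = k * (i + 1)"
proof (cases "a mod k \<le> k - 2")
  case True
  have "a = k * (a div k) + a mod k" by simp
  with True show thesis by (intro two[of "a div k" "a mod k"]) (auto simp: phi_letter_def Let_def)
next
  case False
  have "a mod k < k" using k3 by simp
  with False have m: "a mod k = k - 1" by linarith
  have a: "a = k * (a div k) + (k - 1)" using m mult_div_mod_eq[of k a] by simp
  then have "a + 1 = k * (a div k + 1)" using k3 by (simp add: algebra_simps)
  moreover have "phi_letter k a = [k * (a div k) + k]"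
    using False by (simp add: phi_letter_def Let_def)
  ultimately show thesis using a by (intro one[of "a div k"]) auto
qed

lemma phi_letter_small: "a + 1 < k \<Longrightarrow> phi_letter k a = [0, a + 1]"
  by (auto simp: phi_letter_def Let_def)

lemma phi_letter_last_small: "phi_letter k (k - 1) = [k]"
  using k3 by (auto simp: phi_letter_def Let_def)

lemma phi_letter_ne [simp]: "phi_letter k a \<noteq> []"
  by (cases rule: phi_letter_cases[of a]) auto

lemma phi_eq_Nil [simp]: "phi k w = [] \<longleftrightarrow> w = []"
  by (cases w) auto

lemma last_phi_letter: "last (phi_letter k a) = a + 1"
  by (cases rule: phi_letter_cases[of a]) auto

lemma hd_phi_letter_small: "a + 1 < k \<Longrightarrow> hd (phi_letter k a) = 0"
  by (simp add: phi_letter_small)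

lemma hd_phi_letter_k: "hd (phi_letter k k) = k"
  using k3 by (simp add: phi_letter_def Let_def)

lemma hd_phi_letter_0_or_ge: "hd (phi_letter k a) = 0 \<or> k \<le> hd (phi_letter k a)"
  by (cases rule: phi_letter_cases[of a]) auto

lemma phi_letter_add: "phi_letter k (a + k) = map ((+) k) (phi_letter k a)"
proof -
  have "k \<noteq> 0" using k3 by simp
  then have "(a + k) div k = a div k + 1" by (rule div_add_self2)
  then show ?thesis by (simp add: phi_letter_def Let_def algebra_simps)
qed

lemma phi_map_add: "phi k (map ((+) k) w) = map ((+) k) (phi k w)"
proof (induction w)
  case (Cons a w)
  then show ?case using phi_letter_add[of a] by (simp add: add.commute)
qed simp

lemma phi_concat: "phi k (concat ws) = concat (map (phi k) ws)"
  by (induction ws) auto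

lemma W_snoc: "\<exists>x. W k n = x @ [n]"
proof (induction n)
  case (Suc n)
  then obtain x where "W k n = x @ [n]" by blast
  then have "W k (Suc n) = phi k x @ butlast (phi_letter k n) @ [Suc n]"
    using append_butlast_last_id[OF phi_letter_ne[of n]] by (simp add: W_Suc last_phi_letter)
  then show ?case by (metis append.assoc)
qed simp

lemma W_Cons: "\<exists>y. W k n = 0 # y"
proof (induction n)
  case (Suc n)
  then obtain y where "W k n = 0 # y" by blast
  then show ?case using k3 by (simp add: W_Suc phi_letter_small)
qed simp

text \<open>Every word begins with 0, which is \<open>W k 0\<close>, and \<open>phi\<close>
  preserves prefixes.\<close>

lemma prefix_W: "m \<le> n \<Longrightarrow> prefix (W k m) (W k n)"
proof (induction n arbitrary: m)
  case (Suc n)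
  show ?case
  proof (cases m)
    case 0
    then show ?thesis using W_Cons[of "Suc n"] by auto
  next
    case (Suc m')
    then have "prefix (W k m') (W k n)" using Suc.prems Suc.IH by simp
    then show ?thesis by (auto simp: Suc W_Suc prefix_def)
  qed
qed simp

section \<open>Recursive decompositions\<close>

lemma phi_blocks:
  "phi k (concat (map (W k) (rev [a..<b]))) = concat (map (W k) (rev [Suc a..<Suc b]))"
proof -
  have "rev [Suc a..<Suc b] = map Suc (rev [a..<b])"
    by (simp add: map_Suc_upt rev_map[symmetric] del: upt_Suc)
  then show ?thesis by (simp add: phi_concat W_Suc comp_def del: upt_Suc)
qed

lemma W_small_blocks: "n < k \<Longrightarrow> W k n = concat (map (W k) (rev [0..<n])) @ [n]"
proof (induction n)
  case (Suc n)
  then have "W k (Suc n) = phi k (concat (map (W k) (rev [0..<n])) @ [n])"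
    by (simp add: W_Suc)
  \<comment> \<open>The last letter \<open>n\<close> becomes 0 followed by \<open>n + 1\<close>;
    this \<open>[0]\<close> is \<open>W k 0\<close>, the block missing after the index
    shift.\<close>
  also have "\<dots> = concat (map (W k) (rev [Suc 0..<Suc n])) @ [0] @ [Suc n]"
    unfolding phi_append phi_blocks using Suc.prems by (simp add: phi_letter_small del: upt_Suc)
  also have "\<dots> = concat (map (W k) (rev [0..<Suc n])) @ [Suc n]"
    by (simp add: upt_conv_Cons[of 0 "Suc n"] del: upt_Suc)
  finally show ?case .
qed simp

text \<open>At \<open>n = k\<close> the last letter \<open>k - 1\<close> has the one-letter image
  \<open>k\<close>: no new block \<open>W k 0\<close> arises, and \<open>[k]\<close> is the shifted
  \<open>W k 0\<close>. From there on \<open>phi\<close> commutes with the shift by \<open>k\<close>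
  and merely raises all indices.\<close>

lemma W_blocks:
  "n \<ge> k \<Longrightarrow> W k n = concat (map (W k) (rev [n - k + 1..<n])) @ map ((+) k) (W k (n - k))"
proof (induction n rule: dec_induct)
  case base
  have k_pos: "0 < k" using k3 by simp
  have "W k k = phi k (W k (k - 1))" using k3 W_Suc[of k "k - 1"] by simp
  also have "\<dots> = concat (map (W k) (rev [1..<k])) @ [k]"
    unfolding W_small_blocks[of "k - 1", OF diff_less[OF zero_less_one k_pos]] phi_append phi_blocks
    using k3 by (simp add: phi_letter_last_small[simplified] del: upt_Suc)
  finally show ?case by simp
next
  case (step n)
  then have "W k (Suc n) = phi k (concat (map (W k) (rev [n - k + 1..<n])) @
      map ((+) k) (W k (n - k)))" by (simp add: W_Suc)
  also have "\<dots> = concat (map (W k) (rev [Suc (n - k + 1)..<Suc n])) @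
      map ((+) k) (W k (Suc (n - k)))"
    unfolding phi_append phi_blocks phi_map_add W_Suc ..
  finally show ?case using step by (simp add: Suc_diff_le del: upt_Suc)
qed

lemma length_blocks:
  assumes "n \<ge> k"
  shows "length (concat (map (W k) (rev [n - k + 1..<n]))) = cut k n"
proof -
  have "{n - k + 1..<n} = {n - k + 1..n - 1}" using assms k3 by auto
  then show ?thesis
    by (simp add: length_concat rev_map[symmetric] cut_def comp_def
        interv_sum_list_conv_sum_set_nat)
qed

lemma W_cut:
  assumes "n \<ge> k"
  obtains X where "W k n = X @ W k (n - k + 1) @ map ((+) k) (W k (n - k))"
    "cut k n = length X + length (W k (n - k + 1))"
proof -
  let ?X = "concat (map (W k) (rev [n - k + 2..<n]))"
  have split: "concat (map (W k) (rev [n - k + 1..<n])) = ?X @ W k (n - k + 1)"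
    using assms k3 by (simp add: upt_conv_Cons)
  show thesis
  proof (rule that)
    show "W k n = ?X @ W k (n - k + 1) @ map ((+) k) (W k (n - k))"
      using W_blocks[OF assms] split by simp
    show "cut k n = length ?X + length (W k (n - k + 1))"
      using length_blocks[OF assms] split by (metis length_append)
  qed
qed

section \<open>The words of index at most \<open>k\<close>: ruler structure and its first
  defect\<close>

lemma W_ruler:
  "Suc j < k \<Longrightarrow> W k (Suc j) = W k j @ butlast (W k j) @ [Suc j]"
proof (induction j)
  case 0
  then show ?case by (simp add: W_Suc phi_letter_small)
next
  case (Suc j)
  have b: "butlast (W k (Suc j)) = phi k (butlast (W k j)) @ [0]"
  proof -
    obtain x where x: "W k j = x @ [j]" using W_snoc by blast
    then show ?thesis using Suc.prems by (simp add: W_Suc phi_letter_small butlast_append)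
  qed
  have "W k (Suc (Suc j)) = phi k (W k j @ butlast (W k j) @ [Suc j])"
    using Suc by (simp add: W_Suc)
  also have "\<dots> = W k (Suc j) @ (phi k (butlast (W k j)) @ [0]) @ [Suc (Suc j)]"
    using Suc.prems by (simp add: W_Suc phi_letter_small)
  finally show ?case using b by simp
qed

text \<open>For \<open>j < k\<close> these are the Zimin words, the palindromes 0, 010, 0102010 and
  so on, starting from the empty word.\<close>

definition V :: "nat \<Rightarrow> nat list" where
  "V j = butlast (W k j)"

lemma W_V: "W k j = V j @ [j]"
  using W_snoc[of j] by (auto simp: V_def)

lemma V_0 [simp]: "V 0 = []"
  by (simp add: V_def)

lemma V_Suc: "Suc j < k \<Longrightarrow> V (Suc j) = V j @ [j] @ V j"
  using W_ruler[of j] by (simp add: W_V V_def[symmetric])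

lemma V_phi: "Suc j < k \<Longrightarrow> V (Suc j) = phi k (V j) @ [0]"
  using W_Suc[of k j] by (simp add: W_V phi_letter_small)

lemma rev_V: "j < k \<Longrightarrow> rev (V j) = V j"
  by (induction j) (auto simp: V_Suc)

lemma set_V: "j < k \<Longrightarrow> set (V j) \<subseteq> {..<j}"
  by (induction j) (auto simp: V_Suc)

lemma length_V: "j < k \<Longrightarrow> length (V j) + 1 = 2 ^ j"
  by (induction j) (auto simp: V_Suc)

text \<open>Doubling fails here by one letter: the image of \<open>k - 1\<close> lacks the leading 0
  that would complete the second \<open>V (k - 1)\<close>. This missing letter is responsible for
  the exceptional value at \<open>n = 3 * k - 2\<close>.\<close>

lemma W_k: "W k k = V (k - 1) @ [k - 1] @ butlast (V (k - 1)) @ [k]"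
proof -
  define j where "j = k - 2"
  have j: "k = Suc (Suc j)" using k3 by (simp add: j_def)
  have "W k k = phi k (V (Suc j) @ [Suc j])" using W_Suc[of k "Suc j"] j W_V[of "Suc j"] by simp
  also have "\<dots> = phi k (V j @ [j]) @ phi k (V j) @ [k]"
    using j V_Suc[of j] phi_letter_last_small by simp
  also have "phi k (V j @ [j]) = V (Suc j) @ [Suc j]"
    using W_Suc[of k j] by (simp add: W_V)
  also have "phi k (V j) = butlast (V (Suc j))" using V_phi[of j] j by simp
  finally show ?thesis using j by simp
qed

section \<open>Forbidden factors\<close>

lemma follows_phi_letter:
  assumes "follows k a b"
  shows "follows k (last (phi_letter k a)) (hd (phi_letter k b))"
proof -
  consider "a = 0" | "0 < a" "a < k" | "k \<le> a" by linarith
  then show ?thesis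
  proof cases
    case 1
    then have "b < k" using assms by (simp add: follows_def)
    then have "hd (phi_letter k b) = 0 \<or> hd (phi_letter k b) = k"
      using hd_phi_letter_small[of b] phi_letter_last_small
      by (cases "b + 1 < k") (auto simp: not_less less_Suc_eq_le dest!: le_antisym)
    then show ?thesis using 1 k3 by (auto simp: last_phi_letter follows_def)
  next
    case 2
    then have "b = 0 \<or> b = k" using assms by (simp add: follows_def)
    then have "hd (phi_letter k b) = 0 \<or> hd (phi_letter k b) = k"
      using hd_phi_letter_small[of 0] hd_phi_letter_k k3 by auto
    then show ?thesis using 2 k3 by (auto simp: last_phi_letter follows_def)
  next
    case 3
    then show ?thesis using hd_phi_letter_0_or_ge[of b] by (auto simp: last_phi_letter follows_def)
  qed
qed

lemma successively_phi_letter: "successively (follows k) (phi_letter k a)"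
proof (cases rule: phi_letter_cases[of a])
  case (two i j)
  have j: "j + 1 < k" using two k3 by linarith
  consider "i = 0" | "i = 1" | "i \<ge> 2" by linarith
  then have "follows k (k * i) (k * i + j + 1)"
  proof cases
    case 1
    then show ?thesis using j by (simp add: follows_def)
  next
    case 2
    then show ?thesis using j by (simp add: follows_def)
  next
    case 3
    then have "k * 2 \<le> k * i" by (intro mult_le_mono2)
    then have "k < k * i" "k \<le> k * i + j + 1" using k3 by linarith+
    moreover have "k < a \<Longrightarrow> k \<le> b \<Longrightarrow> follows k a b" for a b by (simp add: follows_def)
    ultimately show ?thesis by blast
  qed
  then show ?thesis using two by simp
qed simp

lemma successively_phi: "successively (follows k) w \<Longrightarrow> successively (follows k) (phi k w)"
proof (induction w rule: induct_list012)
  case (3 a b w)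
  then show ?case
    using follows_phi_letter[of a b] successively_phi_letter[of a]
    by (auto simp: successively_append_iff)
qed (auto simp: successively_phi_letter)

lemma successively_W: "successively (follows k) (W k n)"
  by (induction n) (auto simp: W_Suc successively_phi)

lemma follows_if_sublist: "successively (follows k) w \<Longrightarrow> sublist [a, b] w \<Longrightarrow> follows k a b"
  by (auto simp: sublist_def successively_append_iff)

lemma follows_W: "sublist [a, b] (W k n) \<Longrightarrow> follows k a b"
  using follows_if_sublist successively_W by blast

section \<open>The letter in front of a factor \<open>k k\<close>\<close>

lemma phi_eq_k_k:
  assumes "phi k w = [k, k] @ y"
  shows "\<exists>w'. w = (k - 1) # w'"
proof (cases w)
  case (Cons a w')
  have "a = k - 1"
  proof (cases rule: phi_letter_cases[of a])
    case (two i j) then show ?thesis using assms Cons by auto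
  next
    case (one i) then show ?thesis using assms Cons by auto
  qed
  then show ?thesis using Cons by blast
qed (use assms in auto)

text \<open>The first \<open>k\<close> can only be the image of \<open>k - 1\<close>, a letter
  preceded by 0 alone. The image of 0 ends in 1.\<close>

lemma phi_before_k_k:
  assumes "successively (follows k) w" "phi k w = x @ [a, k, k] @ y"
  shows "a = 1"
  using assms
proof (induction w arbitrary: x)
  case (Cons c w)
  have first: "c = 0" if kk: "phi k w = [k, k] @ z" for z
  proof -
    obtain w' where "w = (k - 1) # w'" using phi_eq_k_k[OF kk] by blast
    then have "follows k c (k - 1)" using Cons.prems by simp
    then show ?thesis using k3 by (auto simp: follows_def not_less)
  qed
  have "successively (follows k) w" using Cons.prems(1) by (auto simp: successively_Cons)
  then have later: "a = 1" if "phi k w = x' @ [a, k, k] @ y" for x'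
    using Cons.IH[OF _ that] by blast
  show ?case
  proof (cases rule: phi_letter_cases[of c])
    case (two i j)
    consider "x = []" | d where "x = [d]" | d d' x' where "x = d # d' # x'"
      by (metis neq_Nil_conv)
    then show ?thesis
    proof cases
      case 1
      \<comment> \<open>The first \<open>k\<close> would be the second letter of an image, which is
        never a multiple of \<open>k\<close> because \<open>j + 1 < k\<close>.\<close>
      then have "k * i + (j + 1) = k" using Cons.prems two by auto
      then have "(k * i + (j + 1)) mod k = 0" by simp
      then show ?thesis using two k3 by simp
    next
      case 2
      then have "a = c + 1" "phi k w = [k, k] @ y" using Cons.prems two by auto
      then show ?thesis using first by simp
    next
      case (3 d d' x')
      then show ?thesis using Cons.prems two later[of x'] by simp
    qed
  next
    case (one i)
    show ?thesis
    proof (cases x)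
      case Nil
      then have "c = 0" using Cons.prems one first[of y] by auto
      then show ?thesis using one k3 by auto
    next
      case (Cons d x')
      then show ?thesis using Cons.prems one later[of x'] by simp
    qed
  qed
qed simp

lemma W_before_k_k:
  assumes "sublist [a, k, k] (W k n)"
  shows "a = 1"
proof (cases n)
  case 0
  then show ?thesis using assms by (auto simp: sublist_def dest!: arg_cong[where f = length])
next
  case (Suc m)
  then show ?thesis using assms phi_before_k_k[OF successively_W[of m]]
    by (auto simp: sublist_def W_Suc)
qed

section \<open>Desubstitution\<close>

lemma phi_letter_eq_0_Cons: "phi_letter k a @ x = 0 # y \<Longrightarrow> a + 1 < k"
  using k3 by (cases rule: phi_letter_cases[of a]) auto

text \<open>The letters below \<open>k - 1\<close> are exactly those whose image begins with 0, and
  the second letter of the image determines them.\<close>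

lemma prefix_phi_cancel:
  assumes "prefix (phi k u) (phi k w)" "\<forall>a\<in>set u. a + 1 < k"
  shows "prefix u w"
  using assms
proof (induction u arbitrary: w)
  case (Cons a u)
  then have a: "phi_letter k a = [0, a + 1]" by (simp add: phi_letter_small)
  show ?case
  proof (cases w)
    case (Cons b w')
    then have "b + 1 < k" using Cons.prems a phi_letter_eq_0_Cons[of b]
      by (auto simp: prefix_def)
    then show ?thesis using Cons.prems Cons.IH[of w'] Cons a by (auto simp: phi_letter_small)
  qed (use Cons a in auto)
qed simp

lemma sublist_phi_cancel:
  assumes "sublist (phi k u) (phi k w)" "\<forall>a\<in>set u. a + 1 < k"
  shows "sublist u w"
  using assms
proof (induction w)
  case (Cons b w)
  show ?case
  proof (cases "u = []")
    case False
    then obtain a u' where u: "u = a # u'" by (cases u) auto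
    then have hd: "phi k u = 0 # (a + 1) # phi k u'"
      using Cons.prems by (simp add: phi_letter_small)
    \<comment> \<open>The letter 0 occurs only at the beginning of an image, so an occurrence of
      \<open>phi k u\<close> cannot start inside the image of \<open>b\<close>.\<close>
    have "sublist (phi k u) (phi k w) \<or> prefix (phi k u) (phi k (b # w))"
    proof (cases rule: phi_letter_cases[of b])
      case (two i j)
      then show ?thesis using Cons.prems hd by (auto simp: sublist_Cons_right)
    next
      case (one i)
      then show ?thesis using Cons.prems hd by (auto simp: sublist_Cons_right)
    qed
    then show ?thesis using Cons prefix_phi_cancel[of u "b # w"]
      by (auto simp: sublist_Cons_right)
  qed simp
qed simp

text \<open>Descent on \<open>q\<close>: a letter strictly between 0 and \<open>k\<close> is
  preceded only by 0, and \<open>0 # Suc q # W k (Suc q)\<close> is the image of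
  \<open>q # W k q\<close>. The descent ends at the factor 0 0, which does not occur.\<close>

lemma not_sublist_Cons_W: "q < k \<Longrightarrow> \<not> sublist (q # W k q) (W k n)"
proof (induction q arbitrary: n)
  case 0
  then show ?case using follows_W[of 0 0 n] by (auto simp: follows_def)
next
  case (Suc q)
  show ?case
  proof
    assume "sublist (Suc q # W k (Suc q)) (W k n)"
    then obtain x y where xy: "W k n = x @ (Suc q # W k (Suc q)) @ y"
      by (auto simp: sublist_def)
    then have "x \<noteq> []" using W_Cons[of n] by auto
    then obtain x' a where x: "x = x' @ [a]" by (metis rev_exhaust)
    have "sublist [a, Suc q] (W k n)" unfolding xy x sublist_def by auto
    then have "follows k a (Suc q)" by (rule follows_W)
    then have a: "a = 0" using Suc.prems k3
      by (cases "a = 0"; cases "a < k"; cases "a = k") (auto simp: follows_def)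
    obtain m where n: "n = Suc m"
      using xy x by (cases n) auto
    have "phi k (q # W k q) = 0 # Suc q # W k (Suc q)"
      using Suc.prems by (simp add: phi_letter_small W_Suc)
    then have "sublist (phi k (q # W k q)) (phi k (W k m))"
      using xy x a n by (auto simp: sublist_def W_Suc[symmetric])
    moreover have "\<forall>a\<in>set (q # W k q). a + 1 < k"
      using set_V[of q] Suc.prems by (auto simp: W_V)
    ultimately have "sublist (q # W k q) (W k m)" by (rule sublist_phi_cancel)
    then show False using Suc by simp
  qed
qed

section \<open>Straddling palindromes\<close>

lemma straddling_palindrome_range:
  assumes "n \<ge> k" "(s, t) \<in> straddling_palindromes k n"
  shows "2 * k - 1 \<le> n \<and> n \<le> 3 * k - 2"
proof -
  obtain X where X: "W k n = X @ W k (n - k + 1) @ map ((+) k) (W k (n - k))"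
    "cut k n = length X + length (W k (n - k + 1))"
    using W_cut[OF assms(1)] .
  let ?c = "n - k + 1"
  obtain y where y: "W k (n - k) = 0 # y" using W_Cons by blast
  have w: "W k n = (X @ V ?c) @ [?c, k] @ map ((+) k) y"
    and e: "cut k n = length (X @ V ?c) + 1"
    using X y W_V[of ?c] by simp_all
  have "sublist (rev [?c, k]) (W k n)"
    by (rule sublist_rev_if_palindrome[OF w, where s = s and t = t])
      (use assms(2) in \<open>auto simp: straddling_palindromes_def e[simplified]\<close>)
  \<comment> \<open>As \<open>?c\<close> is positive, this leaves \<open>k \<le> ?c\<close> and
    \<open>?c < 2 * k\<close>, which is the claimed range of \<open>n\<close>.\<close>
  then have "follows k k ?c" by (auto intro: follows_W)
  then show ?thesis using assms(1) k3 by (auto simp: follows_def)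
qed

lemma sublist_map_add: "sublist (map ((+) k) u) (map ((+) k) v) \<longleftrightarrow> sublist u v"
proof
  assume "sublist (map ((+) k) u) (map ((+) k) v)"
  then have "sublist (map (\<lambda>x. x - k) (map ((+) k) u)) (map (\<lambda>x. x - k) (map ((+) k) v))"
    by (rule map_mono_sublist)
  then show "sublist u v" by (simp add: comp_def)
qed (rule map_mono_sublist)

text \<open>The last block before the cut, \<open>W k (k + q)\<close>, is split at its own cut and
  so ends in \<open>W k (q + 1)\<close> and a shifted \<open>W k q\<close>; the part after the cut
  is a shifted word with prefix \<open>W k q\<close>. What follows in \<open>Z\<close> is read off
  the prefix \<open>W k (q + 1)\<close>, which for \<open>q + 1 = k\<close> is the defective
  \<open>W k k\<close>.\<close>

lemma W_cut_middle:
  assumes "q < k" "n = 2 * k - 1 + q"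
  obtains A Z where
    "W k n = (A @ [q + 1]) @ map ((+) k) (V q) @ [k + q] @ map ((+) k) (V q) @ [k + q] @ map ((+) k) Z"
    "W k (n - k) = V q @ [q] @ Z" "cut k n = length A + 1 + 2 ^ q"
    "q + 1 < k \<Longrightarrow> prefix (V q) Z"
    "q + 1 = k \<Longrightarrow> prefix (butlast (V q) @ [k]) Z"
proof -
  have nk: "n \<ge> k" "n - k + 1 = k + q" "n - k = k + q - 1" using assms k3 by auto
  obtain X where X: "W k n = X @ W k (k + q) @ map ((+) k) (W k (n - k))"
    "cut k n = length X + length (W k (k + q))"
    using W_cut[OF nk(1)] nk by metis
  obtain Y where Y: "W k (k + q) = Y @ W k (q + 1) @ map ((+) k) (W k q)"
    using W_cut[of "k + q"] k3 by auto
  define A where "A = X @ Y @ V (q + 1)"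
  have pre: "prefix (W k q) (W k (n - k))" using nk assms k3 by (intro prefix_W) simp
  then obtain Z where Z: "W k (n - k) = V q @ [q] @ Z" using W_V[of q] by (auto simp: prefix_def)
  show thesis
  proof (rule that[of A Z])
    show "W k n = (A @ [q + 1]) @ map ((+) k) (V q) @ [k + q] @ map ((+) k) (V q) @ [k + q]
        @ map ((+) k) Z"
      using X Y Z W_V[of q] W_V[of "q + 1"] by (simp add: A_def)
    show "cut k n = length A + 1 + 2 ^ q"
      using X Y W_V[of q] W_V[of "q + 1"] length_V[OF assms(1)] by (simp add: A_def)
    show "prefix (V q) Z" if "q + 1 < k"
    proof -
      have "prefix (W k (Suc q)) (W k (n - k))"
        using nk that by (intro prefix_W) simp
      then show ?thesis using V_Suc[of q] that
        unfolding Z W_V[of "Suc q"] by (auto simp: prefix_def)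
    qed
    show "prefix (butlast (V q) @ [k]) Z" if "q + 1 = k"
    proof -
      have "q = k - 1" "k \<le> n - k" using that nk k3 by auto
      then have "prefix (W k k) (W k (n - k))" by (intro prefix_W) simp
      then show ?thesis unfolding Z W_k \<open>q = k - 1\<close> by (auto simp: prefix_def)
    qed
  qed (rule Z)
qed

text \<open>Otherwise the palindrome would contain \<open>q + 1\<close> and the \<open>k\<close>
  after it, hence also \<open>k\<close> followed by \<open>q + 1\<close>, impossible if
  \<open>q + 1 < k\<close>. If \<open>q + 1 = k\<close> this pair is symmetric and a third letter is
  needed: the reversal of \<open>[k, k, k + 1]\<close> has \<open>k + 1\<close> in front of
  \<open>k k\<close>, where only 1 can stand.\<close>

lemma straddling_palindrome_start:
  assumes "q < k"
    and w: "W k n = (A @ [q + 1]) @ map ((+) k) (V q) @ [k + q] @ R"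
    and pal: "palindrome (subword (W k n) s t)" "1 \<le> s" "length A + 1 + 2 ^ q < t"
  shows "length A + 1 < s"
proof (rule ccontr)
  assume "\<not> length A + 1 < s"
  then have s: "s \<le> length A + 1" by simp
  show False
  proof (cases "q + 1 = k")
    case True
    obtain j where j: "q = Suc j" "j > 0" using True k3 by (cases q) auto
    obtain y where "V q = 0 # 1 # y"
    proof -
      have "prefix (W k 1) (W k q)" using j by (intro prefix_W) simp
      then have "prefix [0, 1] (V q @ [q])"
        using k3 by (simp add: W_Suc W_V[symmetric] phi_letter_small)
      then show thesis using j that
        by (cases "V q"; cases "tl (V q)") auto
    qed
    then have w': "W k n = A @ [k, k, k + 1] @ (map ((+) k) y @ [k + q] @ R)"
      using w True by simp
    have len: "(3::nat) \<le> 2 ^ q + 1" using j by (cases j) auto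
    have "sublist (rev [k, k, k + 1]) (W k n)"
      by (rule sublist_rev_if_palindrome[OF w', where s = s and t = t])
        (use pal s len in auto)
    then have "k + 1 = 1" using W_before_k_k[of "k + 1" n] by simp
    then show False using k3 by simp
  next
    case False
    obtain y' where "V q @ [q] = 0 # y'" using W_Cons[of q] W_V[of q] by auto
    then have "map ((+) k) (V q @ [q]) = map ((+) k) (0 # y')" by (rule arg_cong)
    then obtain y where "map ((+) k) (V q) @ [k + q] = k # y" by simp
    then have w': "W k n = A @ [q + 1, k] @ (y @ R)"
      using w by simp
    have "sublist (rev [q + 1, k]) (W k n)"
      by (rule sublist_rev_if_palindrome[OF w', where s = s and t = t])
        (use pal s one_le_power[of "2::nat" q] in \<open>auto simp del: one_le_power\<close>)
    then have "follows k k (q + 1)" by (auto intro: follows_W)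
    then show False using False assms(1) by (auto simp: follows_def)
  qed
qed

text \<open>With \<open>c = k + q\<close> and \<open>U\<close> the shifted \<open>V q\<close>, the
  longest palindromes at the two centres are \<open>U c U\<close> and \<open>U c U c U\<close>; the
  others are trimmings of them that still cross the cut. If \<open>q + 1 = k\<close>, the last
  \<open>U\<close> lacks its final letter, so the second one loses a letter at each end: hence
  \<open>l = 2\<close>.\<close>

lemma straddling_palindromes_eq:
  assumes "q < k" "n = 2 * k - 1 + q"
  defines "e \<equiv> cut k n" and "l \<equiv> (if q + 1 = k then 2 else 1::nat)"
  shows "2 ^ q < e"
    and "straddling_palindromes k n =
      (\<lambda>s. (s, 2 * e - s)) ` {e + 1 - 2 ^ q..<e} \<union>
      (\<lambda>s. (s, 2 * e + 2 ^ q - s)) ` {e + l - 2 ^ q..e}" (is "?L = ?R1 \<union> ?R2")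
proof -
  obtain A Z where
    w: "W k n = (A @ [q + 1]) @ map ((+) k) (V q) @ [k + q] @ map ((+) k) (V q) @ [k + q]
      @ map ((+) k) Z"
    and R: "W k (n - k) = V q @ [q] @ Z" and e: "e = length A + 1 + 2 ^ q"
    and Z1: "q + 1 < k \<Longrightarrow> prefix (V q) Z"
    and Z2: "q + 1 = k \<Longrightarrow> prefix (butlast (V q) @ [k]) Z"
    unfolding e_def using W_cut_middle[OF assms(1,2)] by metis
  show "2 ^ q < e" using e by simp
  define A' U Z' where "A' = A @ [q + 1]" and "U = map ((+) k) (V q)" and "Z' = map ((+) k) Z"
  have w': "W k n = A' @ U @ [k + q] @ U @ [k + q] @ Z'"
    using w by (simp add: A'_def U_def Z'_def)
  have lenA: "length A' = length A + 1" by (simp add: A'_def)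
  have lenU: "length U + 1 = 2 ^ q" using length_V[OF assms(1)] by (simp add: U_def)
  have revU: "rev U = U" using rev_V[OF assms(1)] by (simp add: U_def rev_map)
  have lt_c: "x < k + q" if "x \<in> set U" for x
    using that set_V[OF assms(1)] by (auto simp: U_def)
  have Z1': "prefix U Z'" if "q + 1 < k"
    using map_mono_prefix[OF Z1[OF that]] by (simp add: U_def Z'_def)
  have Z2': "prefix (butlast U @ [2 * k]) Z'" if "q + 1 = k"
    using map_mono_prefix[OF Z2[OF that], of "(+) k"]
    by (simp add: U_def Z'_def map_butlast mult_2)
  have U_ne: "2 \<le> length U" if "q + 1 = k"
  proof -
    have "(2::nat) ^ 2 \<le> 2 ^ q" using that k3 by (intro power_increasing) auto
    then show ?thesis using lenU by simp
  qed
  \<comment> \<open>This is the exclusion of \<open>q # W k q\<close> from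
    \<open>W k (n - k)\<close>, shifted by \<open>k\<close>.\<close>
  have nofac: "\<not> sublist ((k + q) # U @ [k + q]) (U @ [k + q] @ Z')"
    using not_sublist_Cons_W[OF assms(1), of "n - k"] sublist_map_add[of "q # W k q" "W k (n - k)"]
    by (simp add: R W_V[of q] U_def Z'_def)
  have "?L \<subseteq> ?R1 \<union> ?R2"
  proof (rule subrelI)
    fix s t assume "(s, t) \<in> ?L"
    then have st: "1 \<le> s" "s \<le> e" "e < t" "t \<le> length (W k n)"
      and pal: "palindrome (subword (W k n) s t)"
      by (auto simp: straddling_palindromes_def e_def)
    have start: "length A' < s"
      using straddling_palindrome_start[OF assms(1) w pal st(1)] st(3) e lenA by simp
    have eA: "e = length A' + length U + 1" using e lenA lenU by simp
    have "k + q \<notin> set U" using lt_c by auto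
    then have "s + t = 2 * e \<or> s + t = 2 * e + length U + 1"
      using straddling_palindrome_centre[OF w' revU _ pal start _ _ st(4) nofac] st
      unfolding eA by blast
    then have "s + t = 2 * e \<or> s + t = 2 * e + 2 ^ q" unfolding lenU[symmetric] by simp
    then show "(s, t) \<in> ?R1 \<union> ?R2"
    proof
      assume "s + t = 2 * e"
      then have "t = 2 * e - s" "s \<in> {e + 1 - 2 ^ q..<e}" using st start e lenA by auto
      then show ?thesis by blast
    next
      assume sum: "s + t = 2 * e + 2 ^ q"
      \<comment> \<open>This can fail only if \<open>q + 1 = k\<close> and \<open>s\<close> is the
        first position of \<open>U\<close>. Its mirror image \<open>t\<close> then carries
        \<open>2 * k\<close>, while the letters of \<open>U\<close> are smaller.\<close>
      have "e + l - 2 ^ q \<le> s"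
      proof (rule ccontr)
        assume "\<not> ?thesis"
        then have q: "q + 1 = k" and s: "s = length A' + 1"
          using start e lenA by (auto simp: l_def split: if_splits)
        have "W k n ! (s + t - s - 1) = W k n ! (s - 1)"
          by (rule palindrome_subword_nth[OF pal]) (use st in auto)
        moreover have "W k n ! (s - 1) = U ! 0"
          using s U_ne[OF q] by (cases U) (simp_all add: w' nth_append)
        moreover have "U ! 0 < 2 * k"
        proof -
          have "U ! 0 \<in> set U" using U_ne[OF q] by (intro nth_mem) linarith
          then show ?thesis using lt_c q by fastforce
        qed
        moreover have "W k n ! (s + t - s - 1) = 2 * k"
        proof -
          have "s + t - s - 1 = length (A' @ U @ [k + q] @ U @ [k + q] @ butlast U)"
            using sum s e lenA lenU U_ne[OF q] by simp
          moreover obtain Y where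
            "W k n = (A' @ U @ [k + q] @ U @ [k + q] @ butlast U) @ [2 * k] @ Y"
            using Z2'[OF q] by (auto simp: w' prefix_def)
          ultimately show ?thesis by (metis nth_append_length append_Cons)
        qed
        ultimately show False by simp
      qed
      then have "t = 2 * e + 2 ^ q - s" "s \<in> {e + l - 2 ^ q..e}" using sum st by auto
      then show ?thesis by blast
    qed
  qed
  moreover have "?R1 \<subseteq> ?L"
  proof (rule subsetI)
    fix x assume "x \<in> ?R1"
    then obtain s where s: "x = (s, 2 * e - s)" "e + 1 - 2 ^ q \<le> s" "s < e" by auto
    have w1: "W k n = A' @ (U @ [k + q] @ U) @ ([k + q] @ Z')" by (simp add: w')
    have "palindrome (subword (W k n) s (2 * e - s))"
      unfolding w1 by (rule palindrome_centred)
        (use s e lenA lenU revU in \<open>auto simp: palindrome_def\<close>)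
    moreover have "2 * e - s \<le> length (W k n)"
      using s e lenA lenU by (simp add: w')
    ultimately show "x \<in> ?L" using s e by (auto simp: straddling_palindromes_def e_def[symmetric])
  qed
  moreover have "?R2 \<subseteq> ?L"
  proof (rule subsetI)
    fix x assume "x \<in> ?R2"
    then obtain s where s: "x = (s, 2 * e + 2 ^ q - s)" "e + l - 2 ^ q \<le> s" "s \<le> e" by auto
    have "palindrome (subword (W k n) s (2 * e + 2 ^ q - s)) \<and>
      2 * e + 2 ^ q - s \<le> length (W k n)"
    proof (cases "q + 1 = k")
      case True
      obtain Y where Y: "Z' = butlast U @ Y" using Z2'[OF True] by (auto simp: prefix_def)
      \<comment> \<open>Dropping the first letter on the left balances the missing last letter on
        the right: \<open>tl U\<close> and \<open>butlast U\<close> are reversals of each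
        other.\<close>
      have U: "U = hd U # tl U" using U_ne[OF True] by (cases U) auto
      have "rev (tl U) = butlast (rev U)" by (subst (2) U) simp
      then have revtl: "rev (tl U) = butlast U" "rev (butlast U) = tl U"
        using revU by (simp, metis rev_rev_ident)
      have w2: "W k n = (A' @ [hd U]) @ (tl U @ [k + q] @ U @ [k + q] @ butlast U) @ Y"
        unfolding w' Y by (subst (1) U) simp
      have "palindrome (subword (W k n) s (2 * e + 2 ^ q - s))"
        unfolding w2 by (rule palindrome_centred)
          (use s e lenA lenU revU revtl U_ne[OF True] True in \<open>auto simp: palindrome_def l_def\<close>)
      moreover have "2 * e + 2 ^ q - s \<le> length (W k n)"
        using s e lenA lenU True U_ne[OF True] by (simp add: w' Y l_def)
      ultimately show ?thesis ..
    next
      case False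
      then obtain Y where Y: "Z' = U @ Y" using Z1' assms(1) by (auto simp: prefix_def)
      have w2: "W k n = A' @ (U @ [k + q] @ U @ [k + q] @ U) @ Y" by (simp add: w' Y)
      have "palindrome (subword (W k n) s (2 * e + 2 ^ q - s))"
        unfolding w2 by (rule palindrome_centred)
          (use s e lenA lenU revU False in \<open>auto simp: palindrome_def l_def\<close>)
      moreover have "2 * e + 2 ^ q - s \<le> length (W k n)"
        using s e lenA lenU False by (simp add: w' Y l_def)
      ultimately show ?thesis ..
    qed
    then show "x \<in> ?L" using s e by (auto simp: straddling_palindromes_def e_def[symmetric] l_def split: if_splits)
  qed
  ultimately show "?L = ?R1 \<union> ?R2" by blast
qed

text \<open>The two families differ in \<open>s + t\<close>, so they are disjoint, and their sizes
  \<open>2 ^ q - 1\<close> and \<open>2 ^ q + 1 - l\<close> add up to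
  \<open>2 ^ (q + 1) - l\<close>.\<close>

lemma card_straddling_palindromes:
  assumes "q < k" "n = 2 * k - 1 + q"
  shows "card (straddling_palindromes k n) = (if q + 1 = k then 2 ^ k - 2 else 2 ^ (q + 1) - 1)"
proof -
  define e l where "e = cut k n" and "l = (if q + 1 = k then 2 else 1::nat)"
  let ?R1 = "(\<lambda>s. (s, 2 * e - s)) ` {e + 1 - 2 ^ q..<e}"
  let ?R2 = "(\<lambda>s. (s, 2 * e + 2 ^ q - s)) ` {e + l - 2 ^ q..e}"
  note eq = straddling_palindromes_eq[OF assms, folded e_def l_def]
  have "card ?R1 = 2 ^ q - 1"
    using eq(1) by (subst card_image) (auto simp: inj_on_def)
  moreover have "card ?R2 = 2 ^ q + 1 - l"
    using eq(1) by (subst card_image) (auto simp: inj_on_def)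
  moreover have "?R1 \<inter> ?R2 = {}" by auto
  ultimately have "card (straddling_palindromes k n) = 2 ^ q - 1 + (2 ^ q + 1 - l)"
    unfolding eq(2) by (subst card_Un_disjoint) auto
  moreover have "q + 1 = k \<Longrightarrow> (2::nat) ^ k = 2 * 2 ^ q" by auto
  ultimately show ?thesis using one_le_power[of "2::nat" q] by (auto simp: l_def)
qed

end

theorem theorem5p19:
  fixes k n :: nat
  assumes "k \<ge> 3" and "n \<ge> k"
  shows "S k n =
    (if 2 * k - 1 \<le> n \<and> n < 3 * k - 2 then 2 ^ (n + 2 - 2 * k) - 1
     else if n = 3 * k - 2 then 2 ^ k - 2
     else 0)"
proof (cases "2 * k - 1 \<le> n \<and> n \<le> 3 * k - 2")
  case True
  define q where "q = n - (2 * k - 1)"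
  have q: "q < k" "n = 2 * k - 1 + q" using True assms by (auto simp: q_def)
  have "n + 2 - 2 * k = q + 1" "q + 1 = k \<longleftrightarrow> n = 3 * k - 2" using q assms by auto
  then show ?thesis
    using card_straddling_palindromes[OF assms(1) q] True by (auto simp: S_def)
next
  case False
  then have "straddling_palindromes k n = {}"
    using straddling_palindrome_range[OF assms] by (metis ex_in_conv surj_pair)
  then show ?thesis using False assms by (auto simp: S_def)
qed

end
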